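(* Let $L_0\in\mathbb{R}^{m\times n}$ have rank $r\ge1$ and incoherence parameter $\mu$ on its column space, and let $L_l\in\mathbb{R}^{m\times k}$ satisfy $\mathrm{Range}(L_l)=\mathrm{Range}(L_0)$. Let $\delta\in(0,1)$ and $p_0\in(0,1]$, and suppose that each row is sampled independently with probability $p_0$: let $\delta_1,\dots,\delta_m$ be i.i.d. $\mathrm{Ber}(p_0)$ and, for a matrix $X$ with $m$ rows, let $\mathcal{Y}(X)=\sum_j\delta_je_jX_{j:}$ be the matrix of selected rows of $X$. If $$p_0\ge 2\mu\frac{r}{m}\log\frac{r}{\delta},$$ then with probability at least $1-\delta$ one has $\mathrm{rank}(\mathcal{Y}(L_l))=r$ and $\mathrm{Range}(\mathcal{Y}(L_l))=\mathrm{Range}(\mathcal{Y}(L_0))$.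
   Context: $X_{j:}$ denotes the $j$th row of $X$ and $e_j$ the $j$th standard basis vector. With $L_0=U\Sigma V^T$ the skinny SVD ($U\in\mathbb{R}^{m\times r}$), the incoherence condition on the column space with parameter $\mu$ is $\max_{1\le i\le m}\|U^Te_i\|_2^2\le\frac{\mu r}{m}$. *)

theory Defs
  imports "HOL-Probability.Probability"
begin

definition matrix_range :: "real^'n^'m \<Rightarrow> (real^'m) set" where
  "matrix_range A = range (\<lambda>x. A *v x)"

text \<open>
  The skinny SVD of a matrix of rank r: the index type of the singular values has r elements.
  As that type carries no order, the singular values are not required to be sorted.
\<close>
definition skinny_svd ::
  "real^'n^'m \<Rightarrow> real^'r^'m \<Rightarrow> real^'r^'r \<Rightarrow> real^'r^'n \<Rightarrow> bool" where
  "skinny_svd L U S V \<longleftrightarrow>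
     CARD('r) = rank L \<and>
     transpose U ** U = mat 1 \<and>
     transpose V ** V = mat 1 \<and>
     (\<forall>i. 0 < S $ i $ i) \<and> (\<forall>i j. i \<noteq> j \<longrightarrow> S $ i $ j = 0) \<and>
     L = U ** S ** transpose V"

definition incoherent :: "real \<Rightarrow> real^'r^'m \<Rightarrow> bool" where
  "incoherent \<mu> U \<longleftrightarrow>
     (MAX i. (norm (transpose U *v axis i 1))\<^sup>2) \<le> \<mu> * real CARD('r) / real CARD('m)"

text \<open>
  Rows that are not selected are kept as zero rows, so the result has the same shape as the
  argument.  The j-th summand is the outer product of the j-th standard basis vector with the
  j-th row.
\<close>
definition sample_rows :: "('m \<Rightarrow> bool) \<Rightarrow> real^'n^'m \<Rightarrow> real^'n^'m" where
  "sample_rows d X =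
     (\<Sum>j\<in>UNIV. (of_bool (d j) :: real) *\<^sub>R
       ((columnvector (axis j 1) :: real^1^'m) ** (rowvector (row j X) :: real^'n^1)))"

definition iid_bernoulli :: "'a measure \<Rightarrow> ('m \<Rightarrow> 'a \<Rightarrow> bool) \<Rightarrow> real \<Rightarrow> bool" where
  "iid_bernoulli M d p \<longleftrightarrow>
     prob_space.indep_vars M (\<lambda>_. count_space UNIV) d UNIV \<and>
     (\<forall>j. distr M (count_space UNIV) (d j) = measure_pmf (bernoulli_pmf p))"

end

theory Submission
  imports Defs
begin

text \<open>
  Let \<open>u\<^sub>j\<close> be the rows of \<open>U\<close>, a Parseval frame of \<open>\<real>\<^sup>r\<close> with \<open>\<parallel>u\<^sub>j\<parallel>\<^sup>2 \<le> R = \<mu> r / m\<close>, and let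
  \<open>k(S)\<close> be the dimension of the orthogonal complement of the sampled rows \<open>{u\<^sub>j | j \<in> S}\<close>. The
  conclusion holds as soon as \<open>k(S) = 0\<close>, so it suffices to bound \<open>g(q) = E k(S)\<close>, where \<open>S\<close> contains
  each index independently with probability \<open>q\<close>. By the Parseval identity on that complement,
  adding one index at a time to \<open>S\<close> decreases \<open>k\<close> by at least \<open>k(S) / R\<close> in total, and
  Russo's formula \<open>(1 - q) g'(q) = E (\<Sum>\<^sub>j (k(S \<union> {j}) - k(S)))\<close> turns this into
  \<open>g' \<le> - g / R\<close>. Hence the failure probability is at most \<open>g(p\<^sub>0) \<le> r exp (- p\<^sub>0 / R) \<le> \<delta>\<close>, and no
  matrix concentration inequality is needed.
\<close>

subsection \<open>Monotone decay of expectations over random subsets\<close>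

text \<open>The product Bernoulli law on the power set of the index type, written as a polynomial in
  \<open>q\<close> so that expectations can be differentiated in \<open>q\<close>.\<close>

definition subset_weight :: "real \<Rightarrow> 'm::finite set \<Rightarrow> real" where
  "subset_weight q S = (\<Prod>j\<in>UNIV. if j \<in> S then q else 1 - q)"

lemma subset_weight_nonneg:
  assumes "0 \<le> q" "q \<le> 1"
  shows "0 \<le> subset_weight q S"
  using assms unfolding subset_weight_def by (intro prod_nonneg) auto

lemma sum_split_insert:
  fixes h :: "'m::finite set \<Rightarrow> 'b::comm_monoid_add"
  shows "(\<Sum>S\<in>UNIV. h S) = (\<Sum>S | j \<notin> S. h S + h (insert j S))"
proof -
  have inj: "inj_on (insert j) {S. j \<notin> S}"
    by (auto simp: inj_on_def)
  have "S \<in> insert j ` {S. j \<notin> S}" if "j \<in> S" for S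
    using that by (intro image_eqI[of _ _ "S - {j}"]) auto
  then have U: "UNIV = {S. j \<notin> S} \<union> insert j ` {S. j \<notin> S}"
    by auto
  have "(\<Sum>S\<in>UNIV. h S) = (\<Sum>S | j \<notin> S. h S) + (\<Sum>S\<in>insert j ` {S. j \<notin> S}. h S)"
    by (subst U, rule sum.union_disjoint) auto
  also have "(\<Sum>S\<in>insert j ` {S. j \<notin> S}. h S) = (\<Sum>S | j \<notin> S. h (insert j S))"
    using sum.reindex[OF inj, of h] by simp
  finally show ?thesis by (simp add: sum.distrib)
qed

text \<open>By the product rule, the derivative of a weight is a signed sum of products with one
  factor left out. Pairing \<open>S\<close> with \<open>insert j S\<close> turns the signs into
  discrete differences of \<open>f\<close>. Multiplying by \<open>1 - q\<close> restores the factor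
  of the absent index \<open>j\<close>.\<close>

lemma russo_formula:
  fixes f :: "'m::finite set \<Rightarrow> real"
  assumes "q \<noteq> 1"
  shows "((\<lambda>q. \<Sum>S\<in>UNIV. subset_weight q S * f S) has_field_derivative
           (\<Sum>S\<in>UNIV. subset_weight q S * (\<Sum>j\<in>UNIV. f (insert j S) - f S)) / (1 - q)) (at q)"
proof -
  define v where "v j S = (\<Prod>i\<in>UNIV - {j}. if i \<in> S then q else 1 - q)" for j and S :: "'m set"
  have v_insert: "v j (insert j S) = v j S" for j S
    unfolding v_def by (intro prod.cong) auto
  have weight: "(1 - q) * v j S = subset_weight q S" if "j \<notin> S" for j S
    unfolding v_def subset_weight_def using that
    prod.remove[of UNIV j "\<lambda>i. if i \<in> S then q else 1 - q"]
    by simp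
  define sg where "sg j S = (if j \<in> S then 1 else - 1 :: real)" for j and S :: "'m set"
  have deriv_weight: "((\<lambda>q. subset_weight q S) has_field_derivative (\<Sum>j\<in>UNIV. sg j S * v j S)) (at q)"
    for S
    unfolding subset_weight_def v_def
    by (rule has_field_derivative_prod) (auto simp: sg_def intro!: derivative_eq_intros)
  have eq: "(1 - q) * (\<Sum>S\<in>UNIV. sg j S * v j S * f S) =
      (\<Sum>S\<in>UNIV. subset_weight q S * (f (insert j S) - f S))" for j
  proof -
    have "(1 - q) * (\<Sum>S\<in>UNIV. sg j S * v j S * f S) =
        (1 - q) * (\<Sum>S | j \<notin> S. v j S * (f (insert j S) - f S))"
      unfolding sum_split_insert[of _ j]
      by (intro arg_cong2[where f = "(*)"] sum.cong) (auto simp: sg_def v_insert algebra_simps)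
    also have "\<dots> = (\<Sum>S | j \<notin> S. subset_weight q S * (f (insert j S) - f S))"
      unfolding sum_distrib_left by (intro sum.cong) (auto simp: weight[symmetric])
    \<comment> \<open>Sets containing \<open>j\<close> may be added freely, since there
      \<open>insert j S = S\<close> makes the difference vanish.\<close>
    also have "\<dots> = (\<Sum>S\<in>UNIV. subset_weight q S * (f (insert j S) - f S))"
      unfolding sum_split_insert[of _ j] by (intro sum.cong) auto
    finally show ?thesis .
  qed
  have "(\<Sum>S\<in>UNIV. (\<Sum>j\<in>UNIV. sg j S * v j S) * f S) =
      (\<Sum>j\<in>UNIV. \<Sum>S\<in>UNIV. sg j S * v j S * f S)"
    unfolding sum_distrib_right by (rule sum.swap)
  also have "\<dots> = (\<Sum>j\<in>UNIV. (1 - q) * (\<Sum>S\<in>UNIV. sg j S * v j S * f S)) / (1 - q)"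
    unfolding sum_distrib_left[symmetric] using assms by simp
  also have "\<dots> = (\<Sum>j\<in>UNIV. \<Sum>S\<in>UNIV. subset_weight q S * (f (insert j S) - f S)) / (1 - q)"
    unfolding eq ..
  also have "\<dots> = (\<Sum>S\<in>UNIV. subset_weight q S * (\<Sum>j\<in>UNIV. f (insert j S) - f S)) / (1 - q)"
    unfolding sum_distrib_left by (subst sum.swap) simp
  finally have total: "(\<Sum>S\<in>UNIV. (\<Sum>j\<in>UNIV. sg j S * v j S) * f S) =
      (\<Sum>S\<in>UNIV. subset_weight q S * (\<Sum>j\<in>UNIV. f (insert j S) - f S)) / (1 - q)" .
  show ?thesis
    unfolding total[symmetric] by (intro DERIV_sum DERIV_cmult_right deriv_weight)
qed

text \<open>A Gronwall argument: the expectation \<open>g\<close> satisfies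
  \<open>g' \<le> - c * g\<close>, so \<open>g q * exp (c * q)\<close> cannot increase between
  \<open>0\<close> and \<open>p\<close>.\<close>

lemma subset_expectation_exp_decay:
  fixes f :: "'m::finite set \<Rightarrow> real"
  assumes "0 \<le> p" "p \<le> 1" "0 \<le> c"
    and nonneg: "\<And>S. 0 \<le> f S"
    and drop: "\<And>S. c * f S \<le> (\<Sum>j\<in>UNIV. f S - f (insert j S))"
  shows "(\<Sum>S\<in>UNIV. subset_weight p S * f S) \<le> f {} * exp (- c * p)"
proof -
  define g where "g q = (\<Sum>S\<in>UNIV. subset_weight q S * f S)" for q
  \<comment> \<open>Only derivatives in the open interval are used: for \<open>p = 1\<close> the
    formula above divides by zero at the endpoint, where continuity suffices.\<close>
  have "g p * exp (c * p) \<le> g 0 * exp (c * 0)"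
  proof (rule DERIV_nonpos_imp_decreasing_open[OF \<open>0 \<le> p\<close>])
    fix q assume q: "0 < q" "q < p"
    define g' where "g' = (\<Sum>S\<in>UNIV. subset_weight q S * (\<Sum>j\<in>UNIV. f (insert j S) - f S)) / (1 - q)"
    have "q < 1" using q assms by simp
    have "(\<Sum>S\<in>UNIV. subset_weight q S * (\<Sum>j\<in>UNIV. f (insert j S) - f S)) \<le>
        (\<Sum>S\<in>UNIV. subset_weight q S * (- (c * f S)))"
    proof (intro sum_mono mult_left_mono subset_weight_nonneg)
      fix S :: "'m set"
      show "(\<Sum>j\<in>UNIV. f (insert j S) - f S) \<le> - (c * f S)"
        using drop[of S] by (simp add: sum_subtractf)
    qed (use q \<open>q < 1\<close> in auto)
    also have "\<dots> = - (c * g q)"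
      by (simp add: g_def sum_distrib_left sum_negf algebra_simps)
    \<comment> \<open>The factor \<open>1 - q\<close> is inserted to cancel the denominator of
      \<open>g'\<close>; since \<open>c * g q\<close> is nonnegative, it only weakens the
      bound.\<close>
    also have "\<dots> \<le> - (c * g q) * (1 - q)"
    proof -
      have "0 \<le> g q"
        unfolding g_def using q \<open>q < 1\<close>
        by (intro sum_nonneg mult_nonneg_nonneg subset_weight_nonneg nonneg) auto
      then have "0 \<le> (c * g q) * q" using \<open>0 \<le> c\<close> q by simp
      then show ?thesis by (simp add: algebra_simps)
    qed
    finally have "g' \<le> - (c * g q)"
      unfolding g'_def using \<open>q < 1\<close> by (simp add: divide_simps)
    then have "(g' + c * g q) * exp (c * q) \<le> 0"
      by (intro mult_nonpos_nonneg) auto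
    moreover have "(g has_field_derivative g') (at q)"
      unfolding g_def g'_def using \<open>q < 1\<close> by (intro russo_formula) simp
    then have "((\<lambda>q. g q * exp (c * q)) has_field_derivative (g' + c * g q) * exp (c * q)) (at q)"
      by (auto intro!: derivative_eq_intros simp: algebra_simps)
    ultimately show "\<exists>y. ((\<lambda>q. g q * exp (c * q)) has_field_derivative y) (at q) \<and> y \<le> 0"
      by blast
  next
    have "continuous_on {0..p} (\<lambda>q. if b then q else 1 - q)" for b
      by (cases b) (auto intro!: continuous_intros)
    then show "continuous_on {0..p} (\<lambda>q. g q * exp (c * q))"
      unfolding g_def subset_weight_def by (intro continuous_intros)
  qed
  moreover have "g 0 = f {}"
  proof -
    have "subset_weight 0 S = of_bool (S = {})" for S :: "'m set"
      by (auto simp: subset_weight_def)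
    then have "g 0 = (\<Sum>S\<in>UNIV. if S = {} then f S else 0)"
      unfolding g_def by (intro sum.cong) simp_all
    then show ?thesis by simp
  qed
  ultimately have "g p * exp (c * p) \<le> f {}" by simp
  then show ?thesis
    by (simp add: g_def exp_minus field_simps)
qed

section \<open>Transfer from weighted subsets to the probability space\<close>

lemma prob_iid_bernoulli_eq:
  fixes d :: "'m::finite \<Rightarrow> 'a \<Rightarrow> bool"
  assumes "prob_space M" "iid_bernoulli M d p" "0 \<le> p" "p \<le> 1"
  shows "measure M {\<omega> \<in> space M. {j. d j \<omega>} = S} = subset_weight p S"
proof -
  interpret prob_space M by fact
  have indep: "indep_vars (\<lambda>_. count_space UNIV) d UNIV"
    and distr: "\<And>j. distr M (count_space UNIV) (d j) = measure_pmf (bernoulli_pmf p)"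
    using assms(2) by (auto simp: iid_bernoulli_def)
  have meas: "d j \<in> measurable M (count_space UNIV)" for j
    using indep by (auto simp: indep_vars_def)
  have "{\<omega> \<in> space M. {j. d j \<omega>} = S} = (\<Inter>j\<in>UNIV. d j -` {j \<in> S} \<inter> space M)"
    by auto
  then have "prob {\<omega> \<in> space M. {j. d j \<omega>} = S} = (\<Prod>j\<in>UNIV. prob (d j -` {j \<in> S} \<inter> space M))"
    using indep_varsD_finite[OF indep, of "\<lambda>j. {j \<in> S}"] by simp
  also have "\<dots> = subset_weight p S"
    unfolding subset_weight_def
  proof (intro prod.cong refl)
    fix j
    have "prob (d j -` {j \<in> S} \<inter> space M) = measure (measure_pmf (bernoulli_pmf p)) {j \<in> S}"
      unfolding distr[of j, symmetric] by (rule measure_distr[symmetric, OF meas]) simp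
    also have "\<dots> = (if j \<in> S then p else 1 - p)"
      using assms by (simp add: measure_pmf_single)
    finally show "prob (d j -` {j \<in> S} \<inter> space M) = (if j \<in> S then p else 1 - p)" .
  qed
  finally show ?thesis .
qed

text \<open>Markov's inequality in the form needed here: \<open>f\<close> dominates the indicator of
  failure. Any \<open>P\<close> gives a measurable event, because there are only finitely many
  selection patterns.\<close>

lemma prob_iid_bernoulli_ge:
  fixes d :: "'m::finite \<Rightarrow> 'a \<Rightarrow> bool" and f :: "'m set \<Rightarrow> real"
  assumes "prob_space M" "iid_bernoulli M d p" "0 \<le> p" "p \<le> 1"
    and nonneg: "\<And>S. 0 \<le> f S"
    and bad: "\<And>S. \<not> P S \<Longrightarrow> 1 \<le> f S"
  shows "measure M {\<omega> \<in> space M. P {j. d j \<omega>}} \<ge> 1 - (\<Sum>S\<in>UNIV. subset_weight p S * f S)"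
proof -
  interpret prob_space M by fact
  have meas [measurable]: "d j \<in> measurable M (count_space UNIV)" for j
    using assms(2) by (auto simp: iid_bernoulli_def indep_vars_def)
  define A where "A S = {\<omega> \<in> space M. {j. d j \<omega>} = S}" for S
  have A_eq: "A S = {\<omega> \<in> space M. \<forall>j. d j \<omega> = (j \<in> S)}" for S
    by (auto simp: A_def)
  have [measurable]: "A S \<in> events" for S
    unfolding A_eq by measurable
  let ?bad = "\<Union>S\<in>{S. \<not> P S}. A S"
  have compl: "{\<omega> \<in> space M. P {j. d j \<omega>}} = space M - ?bad"
    by (auto simp: A_def)
  have "prob ?bad \<le> (\<Sum>S | \<not> P S. prob (A S))"
    by (rule finite_measure_subadditive_finite) auto
  also have "\<dots> = (\<Sum>S | \<not> P S. subset_weight p S * 1)"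
    unfolding A_def by (simp add: prob_iid_bernoulli_eq[OF assms(1-4)])
  also have "\<dots> \<le> (\<Sum>S | \<not> P S. subset_weight p S * f S)"
    using assms by (intro sum_mono mult_left_mono subset_weight_nonneg) auto
  also have "\<dots> \<le> (\<Sum>S\<in>UNIV. subset_weight p S * f S)"
    using assms by (intro sum_mono2 mult_nonneg_nonneg subset_weight_nonneg) auto
  finally show ?thesis
    unfolding compl by (subst prob_compl) auto
qed

subsection \<open>Complements of sampled frame vectors\<close>

text \<open>The orthogonal complement of the selected vectors; its dimension counts the directions
  that they still miss.\<close>

definition frame_compl :: "('m \<Rightarrow> 'v::euclidean_space) \<Rightarrow> 'm set \<Rightarrow> 'v set" where
  "frame_compl u S = {x. \<forall>j\<in>S. u j \<bullet> x = 0}"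

lemma subspace_frame_compl: "subspace (frame_compl u S)"
  by (auto simp: frame_compl_def subspace_def inner_add_right)

lemma bessel_inequality:
  fixes x :: "'v::euclidean_space"
  assumes "finite B" "pairwise orthogonal B" "\<And>b. b \<in> B \<Longrightarrow> norm b = 1"
  shows "(\<Sum>b\<in>B. (x \<bullet> b)\<^sup>2) \<le> (norm x)\<^sup>2"
proof -
  define y where "y = (\<Sum>b\<in>B. (x \<bullet> b) *\<^sub>R b)"
  have "(norm y)\<^sup>2 = (\<Sum>b\<in>B. (norm ((x \<bullet> b) *\<^sub>R b))\<^sup>2)"
    unfolding y_def using assms
    by (intro norm_sum_Pythagorean) (auto simp: pairwise_def orthogonal_def)
  then have y: "y \<bullet> y = (\<Sum>b\<in>B. (x \<bullet> b)\<^sup>2)"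
    using assms by (simp add: power2_norm_eq_inner[symmetric])
  moreover have "x \<bullet> y = (\<Sum>b\<in>B. (x \<bullet> b)\<^sup>2)"
    by (simp add: y_def inner_sum_right power2_eq_square)
  ultimately have "0 \<le> x \<bullet> x - (\<Sum>b\<in>B. (x \<bullet> b)\<^sup>2)"
    using inner_ge_zero[of "x - y"]
    by (simp add: inner_diff_left inner_diff_right inner_commute)
  then show ?thesis by (simp add: power2_norm_eq_inner)
qed

text \<open>Take an orthonormal basis of the complement. By Parseval its size is the total energy of
  the vectors \<open>u j\<close> on it. A vector orthogonal to the basis contributes nothing; any
  other contributes at most \<open>R\<close> (Bessel) and lowers the dimension by at least
  one.\<close>

lemma dim_frame_compl_drop:
  fixes u :: "'m::finite \<Rightarrow> 'v::euclidean_space"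
  assumes parseval: "\<And>x. (\<Sum>j\<in>UNIV. (u j \<bullet> x)\<^sup>2) = (norm x)\<^sup>2"
    and bound: "\<And>j. (norm (u j))\<^sup>2 \<le> R"
  shows "real (dim (frame_compl u S)) \<le>
    R * (\<Sum>j\<in>UNIV. real (dim (frame_compl u S)) - real (dim (frame_compl u (insert j S))))"
proof -
  let ?K = "frame_compl u"
  obtain B where B: "B \<subseteq> ?K S" "pairwise orthogonal B" "\<And>x. x \<in> B \<Longrightarrow> norm x = 1"
      "independent B" "card B = dim (?K S)" "span B = ?K S"
    using orthonormal_basis_subspace[OF subspace_frame_compl] by metis
  have fin: "finite B" using B(4) by (rule independent_imp_finite)
  have drop: "(\<Sum>b\<in>B. (u j \<bullet> b)\<^sup>2) \<le> R * (real (dim (?K S)) - real (dim (?K (insert j S))))" for j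
  proof (cases "\<forall>b\<in>B. u j \<bullet> b = 0")
    case True
    have "span B \<subseteq> {x. u j \<bullet> x = 0}"
      using True by (intro span_minimal) (auto simp: subspace_hyperplane)
    then have "?K (insert j S) = ?K S"
      using B(6) by (auto simp: frame_compl_def)
    then show ?thesis using True by simp
  next
    case False
    then have "?K (insert j S) \<subset> ?K S"
      using B(1) by (force simp: frame_compl_def)
    then have "dim (?K (insert j S)) < dim (?K S)"
      using subspace_frame_compl by (metis dim_psubset span_eq_iff)
    then have "R * 1 \<le> R * (real (dim (?K S)) - real (dim (?K (insert j S))))"
      using order_trans[OF _ bound[of j], of 0] by (intro mult_left_mono) auto
    moreover have "(\<Sum>b\<in>B. (u j \<bullet> b)\<^sup>2) \<le> R"
      using bessel_inequality[OF fin B(2,3)] bound order_trans by blast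
    ultimately show ?thesis by simp
  qed
  have "real (dim (?K S)) = (\<Sum>b\<in>B. (norm b)\<^sup>2)"
    using B(3,5) by simp
  also have "\<dots> = (\<Sum>b\<in>B. \<Sum>j\<in>UNIV. (u j \<bullet> b)\<^sup>2)"
    by (simp add: parseval)
  also have "\<dots> = (\<Sum>j\<in>UNIV. \<Sum>b\<in>B. (u j \<bullet> b)\<^sup>2)"
    by (rule sum.swap)
  also have "\<dots> \<le> (\<Sum>j\<in>UNIV. R * (real (dim (?K S)) - real (dim (?K (insert j S)))))"
    by (intro sum_mono drop)
  finally show ?thesis by (simp add: sum_distrib_left)
qed

subsection \<open>Row sampling\<close>

lemma sample_rows_nth: "sample_rows d X $ i = (if d i then X $ i else 0)"
proof -
  have "sample_rows d X $ i $ k = (\<Sum>j\<in>UNIV. if j = i then of_bool (d j) * X $ j $ k else 0)" for k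
    unfolding sample_rows_def sum_component
    by (intro sum.cong) (auto simp: columnvector_def rowvector_def matrix_matrix_mult_def row_def
        axis_def)
  then show ?thesis by (simp add: vec_eq_iff)
qed

text \<open>Selecting rows acts as a coordinate projection on the range, so matrices with equal
  ranges keep equal ranges after sampling. This is what lets \<open>U\<close> stand in for
  \<open>L0\<close> and \<open>Ll\<close>.\<close>

lemma matrix_range_sample_rows:
  "matrix_range (sample_rows d X) = (\<lambda>y. \<chi> i. if d i then y $ i else 0) ` matrix_range X"
proof -
  have "sample_rows d X *v x = (\<chi> i. if d i then (X *v x) $ i else 0)" for x
    by (simp add: vec_eq_iff matrix_vector_mul_component sample_rows_nth)
  then show ?thesis by (auto simp: matrix_range_def image_image)
qed

text \<open>A kernel vector of the sampled matrix is orthogonal to every selected row, so a trivial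
  complement means injectivity.\<close>

lemma rank_sample_rows_full:
  fixes U :: "real^'r^'m"
  assumes "frame_compl (($) U) {j. d j} = {0}"
  shows "rank (sample_rows d U) = CARD('r)"
proof -
  have "x = 0" if "sample_rows d U *v x = 0" for x
  proof -
    have "U $ j \<bullet> x = 0" if "d j" for j
      using that arg_cong[OF \<open>sample_rows d U *v x = 0\<close>, of "\<lambda>y. y $ j"]
      by (simp add: matrix_vector_mul_component sample_rows_nth)
    then have "x \<in> frame_compl (($) U) {j. d j}"
      by (simp add: frame_compl_def)
    then show ?thesis using assms by simp
  qed
  then show ?thesis
    unfolding full_rank_injective using linear_injective_0[OF matrix_vector_mul_linear] by blast
qed

text \<open>Orthonormal columns make \<open>U\<close> an isometry; the sum is the squared norm of
  \<open>U *v x\<close> in coordinates.\<close>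

lemma parseval_rows:
  fixes U :: "real^'r^'m"
  assumes "transpose U ** U = mat 1"
  shows "(\<Sum>j\<in>UNIV. (U $ j \<bullet> x)\<^sup>2) = (norm x)\<^sup>2"
proof -
  have "(\<Sum>j\<in>UNIV. (U $ j \<bullet> x)\<^sup>2) = (U *v x) \<bullet> (U *v x)"
    by (simp add: inner_vec_def[of "U *v x"] matrix_vector_mul_component power2_eq_square)
  also have "\<dots> = x \<bullet> ((transpose U ** U) *v x)"
    by (metis dot_lmul_matrix inner_commute matrix_vector_mul_assoc vector_transpose_matrix
        transpose_transpose)
  finally show ?thesis by (simp add: assms power2_norm_eq_inner)
qed

text \<open>The factorization gives one inclusion, and \<open>U\<close> has only
  \<open>rank L\<close> columns, so a dimension count gives equality.\<close>

lemma skinny_svd_range: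
  fixes U :: "real^'r^'m"
  assumes "skinny_svd L U S V"
  shows "matrix_range U = matrix_range L"
proof -
  have L: "L = U ** (S ** transpose V)" and rank: "CARD('r) = rank L"
    using assms by (auto simp: skinny_svd_def matrix_mul_assoc)
  have sub: "matrix_range L \<subseteq> matrix_range U"
    unfolding L matrix_range_def by (auto simp: matrix_vector_mul_assoc[symmetric])
  have "dim (matrix_range U) \<le> dim (matrix_range L)"
    using rank_bound[of U] rank by (simp add: matrix_range_def rank_dim_range[symmetric])
  moreover have "subspace (matrix_range X)" for X :: "real^'k^'m"
    unfolding matrix_range_def by (intro linear_subspace_image matrix_vector_mul_linear subspace_UNIV)
  ultimately show ?thesis
    using subspace_dim_equal[OF _ _ sub] by (simp add: matrix_range_def linear_subspace_image)
qed

theorem theorem4: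
  fixes L0 :: "real^'n^'m" and Ll :: "real^'k^'m"
    and U :: "real^'r^'m" and S :: "real^'r^'r" and V :: "real^'r^'n"
    and r :: nat and \<mu> \<delta> p0 :: real
    and M :: "'a measure" and d :: "'m \<Rightarrow> 'a \<Rightarrow> bool"
  assumes "rank L0 = r" and "r \<ge> 1"
    and "skinny_svd L0 U S V"
    and "incoherent \<mu> U"
    and "matrix_range Ll = matrix_range L0"
    and "0 < \<delta>" and "\<delta> < 1"
    and "0 < p0" and "p0 \<le> 1"
    and "prob_space M"
    and "iid_bernoulli M d p0"
    and "p0 \<ge> 2 * \<mu> * (real r / real CARD('m)) * ln (real r / \<delta>)"
  shows "measure M {\<omega> \<in> space M.
           rank (sample_rows (\<lambda>j. d j \<omega>) Ll) = r \<and>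
           matrix_range (sample_rows (\<lambda>j. d j \<omega>) Ll) =
             matrix_range (sample_rows (\<lambda>j. d j \<omega>) L0)} \<ge> 1 - \<delta>"
proof -
  have r: "CARD('r) = r" and UU: "transpose U ** U = mat 1"
    using assms by (auto simp: skinny_svd_def)
  define R where "R = \<mu> * real r / real CARD('m)"
  define f where "f T = real (dim (frame_compl (($) U) T))" for T
  have bound: "(norm (U $ j))\<^sup>2 \<le> R" for j
  proof -
    have "transpose U *v axis j 1 = U $ j"
      by (simp add: vec_eq_iff matrix_vector_mult_def transpose_def axis_def if_distrib cong: if_cong)
    then have "(norm (U $ j))\<^sup>2 \<le> (MAX i. (norm (transpose U *v axis i 1))\<^sup>2)"
      by (intro Max_ge) (auto intro!: image_eqI[of _ _ j])
    also have "\<dots> \<le> R" using assms(4) by (simp only: incoherent_def R_def r)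
    finally show ?thesis .
  qed
  \<comment> \<open>Otherwise every row of \<open>U\<close> would vanish, contradicting Parseval on
    a unit vector.\<close>
  have "R > 0"
  proof (rule ccontr)
    assume "\<not> R > 0"
    then have "U $ j = 0" for j
      using order_trans[OF bound[of j], of 0] by simp
    then have "(norm (axis undefined 1 :: real^'r))\<^sup>2 = 0"
      using parseval_rows[OF UU, of "axis undefined 1"] by simp
    then show False by simp
  qed
  have "(\<Sum>T\<in>UNIV. subset_weight p0 T * f T) \<le> f {} * exp (- (1 / R) * p0)"
  proof (rule subset_expectation_exp_decay)
    show "1 / R * f T \<le> (\<Sum>j\<in>UNIV. f T - f (insert j T))" for T
      using dim_frame_compl_drop[of "($) U" R T, OF parseval_rows[OF UU] bound] \<open>R > 0\<close>
      by (simp add: f_def field_simps)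
  qed (use assms \<open>R > 0\<close> in \<open>auto simp: f_def\<close>)
  also have "f {} = real r"
    by (simp add: f_def frame_compl_def r)
  also have "real r * exp (- (1 / R) * p0) \<le> \<delta>"
  proof -
    \<comment> \<open>Nonnegativity, from \<open>r \<ge> 1 > \<delta>\<close>, lets twice the
      logarithm dominate the logarithm itself; the resulting \<open>\<delta> / r\<close> absorbs the
      initial dimension \<open>r\<close>.\<close>
    have "0 \<le> ln (real r / \<delta>)" using assms by (simp add: field_simps)
    moreover have "2 * R * ln (real r / \<delta>) \<le> p0"
      using assms(12) by (simp add: R_def algebra_simps)
    then have "2 * ln (real r / \<delta>) \<le> p0 / R"
      using \<open>R > 0\<close> by (simp add: field_simps)
    ultimately have "exp (- (p0 / R)) \<le> exp (- ln (real r / \<delta>))"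
      by simp
    also have "\<dots> = \<delta> / real r"
      using assms by (simp add: exp_minus)
    finally show ?thesis using assms by (simp add: field_simps)
  qed
  finally have fail: "(\<Sum>T\<in>UNIV. subset_weight p0 T * f T) \<le> \<delta>" .
  let ?good = "\<lambda>T. rank (sample_rows (\<lambda>j. j \<in> T) Ll) = r \<and>
    matrix_range (sample_rows (\<lambda>j. j \<in> T) Ll) = matrix_range (sample_rows (\<lambda>j. j \<in> T) L0)"
  have "1 - (\<Sum>T\<in>UNIV. subset_weight p0 T * f T) \<le> measure M {\<omega> \<in> space M. ?good {j. d j \<omega>}}"
  proof (rule prob_iid_bernoulli_ge)
    fix T assume bad: "\<not> ?good T"
    \<comment> \<open>A dimension below one is zero, so the selected rows of \<open>U\<close> span.
      The two sampled ranges agree for every \<open>T\<close>, hence only the rank can fail.\<close>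
    show "1 \<le> f T"
    proof (rule ccontr)
      assume "\<not> 1 \<le> f T"
      then have "dim (frame_compl (($) U) T) = 0"
        unfolding f_def by linarith
      then have "frame_compl (($) U) T = {0}"
        using subspace_0[OF subspace_frame_compl[of "($) U" T]] by (auto simp: dim_eq_0)
      then have "rank (sample_rows (\<lambda>j. j \<in> T) U) = r"
        using rank_sample_rows_full[of U "\<lambda>j. j \<in> T"] r by simp
      moreover have "matrix_range (sample_rows (\<lambda>j. j \<in> T) Ll) =
          matrix_range (sample_rows (\<lambda>j. j \<in> T) U)"
        using assms(5) skinny_svd_range[OF assms(3)] by (simp add: matrix_range_sample_rows)
      ultimately have "rank (sample_rows (\<lambda>j. j \<in> T) Ll) = r"
        by (simp add: rank_dim_range matrix_range_def)
      then show False using bad assms(5) by (simp add: matrix_range_sample_rows)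
    qed
  qed (use assms in \<open>auto simp: f_def\<close>)
  then show ?thesis using fail by simp
qed

end
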